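(* Let $T$ be a closed operator in a complex uniformly convex (complex) Banach space $\mathcal{X}$. If there exist a non-empty open subset $U\subset\rho(T)$ and a constant $M>0$ such that $$\|(T-\lambda)^{-1}\|=M\quad\text{for all }\lambda\in U,$$ then $\|(T-\lambda)^{-1}\|\geq M$ for all $\lambda\in\rho(T)$.
   Context: $\rho(T)$ denotes the resolvent set of $T$. A complex normed space $\mathcal{X}$ is called complex uniformly convex if for every $\varepsilon>0$ there exists $\delta>0$ such that for all $x,y\in\mathcal{X}$: if $\|x+\zeta y\|\leq1$ for all $\zeta\in\mathbb{C}$ with $|\zeta|<1$, and $\|y\|>\varepsilon$, then $\|x\|<1-\delta$. *)

theory Defs
  imports "HOL-Analysis.Analysis"
begin

class complex_vector = real_vector +
  fixes scaleC :: "complex \<Rightarrow> 'a \<Rightarrow> 'a"  (infixr \<open>*\<^sub>C\<close> 75)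
  assumes scaleC_add_right: "a *\<^sub>C (x + y) = a *\<^sub>C x + a *\<^sub>C y"
    and scaleC_add_left: "(a + b) *\<^sub>C x = a *\<^sub>C x + b *\<^sub>C x"
    and scaleC_scaleC: "a *\<^sub>C (b *\<^sub>C x) = (a * b) *\<^sub>C x"
    and scaleC_one: "1 *\<^sub>C x = x"
    and scaleR_scaleC: "scaleR r x = complex_of_real r *\<^sub>C x"

class complex_normed_vector = complex_vector + real_normed_vector +
  assumes norm_scaleC: "norm (a *\<^sub>C x) = cmod a * norm x"

class complex_banach = complex_normed_vector + banach

global_interpretation complex_vector:
  vector_space "scaleC :: complex \<Rightarrow> 'a \<Rightarrow> 'a::complex_vector"
  by unfold_locales
    (simp_all add: scaleC_add_right scaleC_add_left scaleC_scaleC scaleC_one)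

definition complex_uniformly_convex :: "'a::complex_normed_vector itself \<Rightarrow> bool" where
  "complex_uniformly_convex _ \<longleftrightarrow>
     (\<forall>\<epsilon>>0. \<exists>\<delta>>0. \<forall>x y :: 'a.
        (\<forall>\<zeta>. cmod \<zeta> < 1 \<longrightarrow> norm (x + \<zeta> *\<^sub>C y) \<le> 1) \<and> norm y > \<epsilon>
          \<longrightarrow> norm x < 1 - \<delta>)"

text \<open>
  A possibly unbounded operator is given by its domain \<open>D\<close>, which need not be dense, and a total
  function \<open>T\<close> of which only the values on \<open>D\<close> matter.
\<close>

definition closed_operator :: "'a::complex_normed_vector set \<Rightarrow> ('a \<Rightarrow> 'a) \<Rightarrow> bool" where
  "closed_operator D T \<longleftrightarrow>
     complex_vector.subspace D \<and>
     (\<forall>x\<in>D. \<forall>y\<in>D. T (x + y) = T x + T y) \<and>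
     (\<forall>a. \<forall>x\<in>D. T (a *\<^sub>C x) = a *\<^sub>C T x) \<and>
     closed {(x, T x) | x. x \<in> D}"

text \<open>
  The resolvent is \<open>(T - \<mu>)\<^sup>-\<^sup>1\<close>. It is meaningful only for \<open>\<mu>\<close> in the resolvent set.
\<close>

definition resolvent ::
    "'a::complex_normed_vector set \<Rightarrow> ('a \<Rightarrow> 'a) \<Rightarrow> complex \<Rightarrow> 'a \<Rightarrow> 'a" where
  "resolvent D T \<mu> = inv_into D (\<lambda>x. T x - \<mu> *\<^sub>C x)"

definition resolvent_set ::
    "'a::complex_normed_vector set \<Rightarrow> ('a \<Rightarrow> 'a) \<Rightarrow> complex set" where
  "resolvent_set D T =
     {\<mu>. bij_betw (\<lambda>x. T x - \<mu> *\<^sub>C x) D UNIV \<and> bounded_linear (resolvent D T \<mu>)}"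

end

theory Submission
  imports Defs
begin

text \<open>
  Fix \<open>\<alpha> \<in> U\<close>, write \<open>R = (T - \<alpha>)\<^sup>-\<^sup>1\<close>, and let \<open>\<parallel>e\<parallel> \<le> 1\<close> with \<open>\<parallel>R e\<parallel>\<close> close to \<open>M\<close>.
  Averaging \<open>(T - \<alpha> - r w)\<^sup>-\<^sup>1 e = \<Sum>\<^sub>k r\<^sup>k w\<^sup>k R\<^bsup>k+1\<^esup> e\<close> over roots of unity \<open>w\<close>
  against the nonnegative weight \<open>1 + Re (\<zeta> / w)\<close> shows \<open>\<parallel>R e + (\<zeta> r / 2) R\<^sup>2 e\<parallel> \<le> M\<close>
  for all \<open>\<bar>\<zeta>\<bar> \<le> 1\<close>, so complex uniform convexity forces \<open>R\<^sup>2 e\<close> to be small. For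
  \<open>\<mu> \<in> \<rho>(T)\<close> and \<open>h = \<mu> - \<alpha>\<close>, the resolvent identity gives
  \<open>(T - \<mu>)\<^sup>-\<^sup>1 e = R e + h R\<^sup>2 e + h\<^sup>2 (T - \<mu>)\<^sup>-\<^sup>1 R\<^sup>2 e\<close>, whose norm is therefore close to \<open>M\<close>.
\<close>

section \<open>Weighted averages over roots of unity\<close>

lemma sum_powers_root_unity:
  fixes N m :: nat
  assumes "N > 0"
  defines "q \<equiv> exp (2 * of_real pi * \<i> / of_nat N)"
  shows "(\<Sum>j<N. (q ^ j) ^ m) = (if N dvd m then of_nat N else 0)"
proof -
  have qm: "q ^ m = exp (2 * of_real pi * \<i> * of_nat m / of_nat N)"
    unfolding q_def by (simp add: exp_of_nat_mult [symmetric] mult_ac)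
  have iff: "q ^ m = 1 \<longleftrightarrow> N dvd m"
    unfolding qm using assms(1) by (intro complex_root_unity_eq_1) simp
  have qN: "q ^ N = 1"
    unfolding q_def using assms(1) by (simp add: exp_of_nat_mult [symmetric])
  \<comment> \<open>Exchanging the exponents leaves a geometric sum whose ratio \<open>q ^ m\<close>
    is itself an \<open>N\<close>-th root of unity.\<close>
  have *: "(\<Sum>j<N. (q ^ j) ^ m) = (\<Sum>j<N. (q ^ m) ^ j)"
    by (simp add: power_mult [symmetric] mult.commute)
  show ?thesis
  proof (cases "N dvd m")
    case True
    then show ?thesis unfolding * using iff by simp
  next
    case False
    have "(q ^ m) ^ N = 1"
      by (metis qN mult.commute power_mult power_one)
    then show ?thesis unfolding * using iff False by (simp add: geometric_sum)
  qed
qed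

text \<open>Average the polynomial over the \<open>N\<close>-th roots of unity with the weight 1 +
  Re(\<zeta>/w). The weight is nonnegative with mean 1, so the average keeps the bound
  \<open>B\<close>. Orthogonality leaves the coefficients 0 and 1; the index \<open>N - 1\<close>
  survives too, by aliasing, since w = w^(-(N-1)) at such roots.\<close>

lemma norm_truncation_le:
  fixes a :: "nat \<Rightarrow> 'a::complex_normed_vector"
  assumes N: "N \<ge> 3" and \<zeta>: "cmod \<zeta> \<le> 1"
    and bd: "\<And>w. cmod w = 1 \<Longrightarrow> norm (\<Sum>k<N. w ^ k *\<^sub>C a k) \<le> B"
  shows "norm (a 0 + (\<zeta> / 2) *\<^sub>C a 1 + (cnj \<zeta> / 2) *\<^sub>C a (N - 1)) \<le> B"
proof -
  define q where "q = exp (2 * of_real pi * \<i> / of_nat N)"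
  \<comment> \<open>The power \<open>N - 1\<close> stands for the inverse of \<open>q ^ j\<close>,
    so that all exponents remain natural numbers.\<close>
  define wt where "wt j = 1 + Re (\<zeta> * (q ^ j) ^ (N - 1))" for j
  have ur: "cmod q = 1" "q ^ N = 1"
    unfolding q_def using N by (simp_all add: exp_of_nat_mult [symmetric])
  have ps: "(\<Sum>j<N. (q ^ j) ^ m) = (if N dvd m then of_nat N else 0)" for m
    using sum_powers_root_unity[of N m] N unfolding q_def by simp
  have nrm: "cmod (q ^ j) = 1" for j
    using ur by (simp add: norm_power)
  have inv: "cnj ((q ^ j) ^ (N - 1)) = q ^ j" for j
  proof -
    have "(q ^ j) ^ (N - 1) * q ^ j = (q ^ j) ^ N"
      using N by (metis One_nat_def Suc_pred less_le_trans mult.commute power_Suc zero_less_numeral)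
    also have "\<dots> = 1" by (metis ur(2) mult.commute power_mult power_one)
    finally have e: "(q ^ j) ^ (N - 1) * q ^ j = 1" .
    have "(q ^ j) * cnj (q ^ j) = 1"
      using nrm[of j] by (simp only: complex_norm_square [symmetric]) simp
    with e have "(q ^ j) ^ (N - 1) = cnj (q ^ j)"
      by (metis mult.assoc mult.commute mult.right_neutral)
    then show ?thesis by simp
  qed
  \<comment> \<open>Written as a combination of three powers of \<open>q ^ j\<close>, the weight has
    moments that are sums of powers of roots of unity.\<close>
  have wt_eq: "complex_of_real (wt j) = 1 + (\<zeta> / 2) * (q ^ j) ^ (N - 1) + (cnj \<zeta> / 2) * q ^ j" for j
  proof -
    have "complex_of_real (2 * Re z) = z + cnj z" for z
      by (simp add: complex_add_cnj)
    from this[of "\<zeta> * (q ^ j) ^ (N - 1)"] show ?thesis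
      unfolding wt_def complex_cnj_mult inv by (simp add: field_simps)
  qed
  have wt_ge: "0 \<le> wt j" for j
  proof -
    have "cmod (\<zeta> * (q ^ j) ^ (N - 1)) \<le> 1"
      using \<zeta> nrm[of j] by (simp add: norm_mult norm_power)
    then show ?thesis
      unfolding wt_def using abs_Re_le_cmod[of "\<zeta> * (q ^ j) ^ (N - 1)"] by linarith
  qed
  \<comment> \<open>Modulo \<open>N\<close> the exponent is k - 1; the case k = 0 is separate
    because natural subtraction truncates.\<close>
  have d1: "N dvd k + (N - 1) \<longleftrightarrow> k = 1" if "k < N" for k
  proof (cases "k = 0")
    case True
    then show ?thesis using N by (auto dest: dvd_imp_le)
  next
    case False
    then have "k + (N - 1) = (k - 1) + N" using N by simp
    then have "N dvd k + (N - 1) \<longleftrightarrow> N dvd k - 1" by simp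
    then show ?thesis using that False by (auto dest: dvd_imp_le)
  qed
  have d2: "N dvd k + 1 \<longleftrightarrow> k = N - 1" if "k < N" for k
    using that by (auto dest: dvd_imp_le)
  have d0: "N dvd k \<longleftrightarrow> k = 0" if "k < N" for k
    using that by (auto dest: dvd_imp_le)
  have moment: "(\<Sum>j<N. complex_of_real (wt j) * (q ^ j) ^ k) =
      of_nat N * ((if k = 0 then 1 else 0) + (if k = 1 then \<zeta> / 2 else 0)
        + (if k = N - 1 then cnj \<zeta> / 2 else 0))" if "k < N" for k
  proof -
    have "(\<Sum>j<N. complex_of_real (wt j) * (q ^ j) ^ k) =
        (\<Sum>j<N. (q ^ j) ^ k) + (\<zeta> / 2) * (\<Sum>j<N. (q ^ j) ^ (k + (N - 1)))
          + (cnj \<zeta> / 2) * (\<Sum>j<N. (q ^ j) ^ (k + 1))"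
      unfolding wt_eq sum_distrib_left sum.distrib [symmetric]
      by (rule sum.cong[OF refl], simp only: power_add power_one_right) (simp add: algebra_simps)
    then show ?thesis
      unfolding ps using d0[OF that] d1[OF that] d2[OF that] by (simp add: algebra_simps)
  qed
  define A where "A = a 0 + (\<zeta> / 2) *\<^sub>C a 1 + (cnj \<zeta> / 2) *\<^sub>C a (N - 1)"
  \<comment> \<open>The zeroth moment is the total mass, computed in the complex numbers and pulled
    back by injectivity of \<open>of_real\<close>.\<close>
  have wt_sum: "(\<Sum>j<N. wt j) = real N"
  proof -
    have "complex_of_real (\<Sum>j<N. wt j) = of_real (real N)"
      using moment[of 0] N by simp
    then show ?thesis by (simp only: of_real_eq_iff)
  qed
  have "(\<Sum>j<N. complex_of_real (wt j) *\<^sub>C (\<Sum>k<N. (q ^ j) ^ k *\<^sub>C a k)) =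
      (\<Sum>j<N. \<Sum>k<N. (complex_of_real (wt j) * (q ^ j) ^ k) *\<^sub>C a k)"
    by (simp add: complex_vector.scale_sum_right)
  also have "\<dots> = (\<Sum>k<N. (\<Sum>j<N. complex_of_real (wt j) * (q ^ j) ^ k) *\<^sub>C a k)"
    by (subst sum.swap) (simp add: complex_vector.scale_sum_left)
  also have "\<dots> = of_nat N *\<^sub>C (\<Sum>k<N. ((if k = 0 then 1 else 0) + (if k = 1 then \<zeta> / 2 else 0)
        + (if k = N - 1 then cnj \<zeta> / 2 else 0)) *\<^sub>C a k)"
    by (simp add: moment complex_vector.scale_sum_right)
  also have "(\<Sum>k<N. ((if k = 0 then 1 else 0) + (if k = 1 then \<zeta> / 2 else 0)
        + (if k = N - 1 then cnj \<zeta> / 2 else 0)) *\<^sub>C a k) = A"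
  proof -
    have "(\<Sum>k<N. (if k = i then c else 0) *\<^sub>C a k) = c *\<^sub>C a i" if "i < N" for i c
    proof -
      have "(\<Sum>k<N. (if k = i then c else 0) *\<^sub>C a k) = (\<Sum>k<N. if k = i then c *\<^sub>C a i else 0)"
        by (rule sum.cong) auto
      then show ?thesis using that by simp
    qed
    from this[of 0 1] this[of 1 "\<zeta> / 2"] this[of "N - 1" "cnj \<zeta> / 2"] show ?thesis
      using N by (simp add: A_def complex_vector.scale_left_distrib sum.distrib)
  qed
  finally have eq: "of_nat N *\<^sub>C A =
    (\<Sum>j<N. complex_of_real (wt j) *\<^sub>C (\<Sum>k<N. (q ^ j) ^ k *\<^sub>C a k))" by simp
  have "real N * norm A = norm (of_nat N *\<^sub>C A)"
    by (simp add: norm_scaleC)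
  also have "\<dots> \<le> (\<Sum>j<N. wt j * B)"
    unfolding eq
  proof (rule sum_norm_le)
    fix j
    show "norm (complex_of_real (wt j) *\<^sub>C (\<Sum>k<N. (q ^ j) ^ k *\<^sub>C a k)) \<le> wt j * B"
      using wt_ge[of j] bd[OF nrm[of j]] by (simp add: norm_scaleC mult_left_mono)
  qed
  also have "\<dots> = real N * B"
    by (simp add: wt_sum sum_distrib_right [symmetric])
  finally show ?thesis using N unfolding A_def by simp
qed

section \<open>Operator norms and resolvent identities\<close>

lemma onorm_less_witness:
  fixes f :: "'a::real_normed_vector \<Rightarrow> 'b::real_normed_vector"
  assumes f: "bounded_linear f" and "0 \<le> c" "c < onorm f"
  obtains e where "norm e = 1" "c < norm (f e)"
proof -
  interpret f: bounded_linear f by fact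
  obtain x where x: "c * norm x < norm (f x)"
    using onorm_bound[of c f] assms(2,3) by (meson not_le)
  then have "x \<noteq> 0" by (auto simp: f.zero)
  then have "norm (x /\<^sub>R norm x) = 1" "c < norm (f (x /\<^sub>R norm x))"
    using x by (simp_all add: f.scaleR field_simps)
  then show ?thesis by (rule that)
qed

lemma resolvent_in_domain:
  assumes "\<mu> \<in> resolvent_set D T"
  shows "resolvent D T \<mu> x \<in> D"
  using assms unfolding resolvent_set_def resolvent_def bij_betw_def
  by (metis (mono_tags, lifting) UNIV_I inv_into_into mem_Collect_eq)

lemma resolvent_right_inverse:
  assumes "\<mu> \<in> resolvent_set D T"
  shows "T (resolvent D T \<mu> x) - \<mu> *\<^sub>C resolvent D T \<mu> x = x"
  using assms bij_betw_inv_into_right[of "\<lambda>x. T x - \<mu> *\<^sub>C x" D UNIV x]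
  unfolding resolvent_set_def resolvent_def by simp

lemma resolvent_left_inverse:
  assumes "\<mu> \<in> resolvent_set D T" "x \<in> D"
  shows "resolvent D T \<mu> (T x - \<mu> *\<^sub>C x) = x"
  using assms bij_betw_inv_into_left[of "\<lambda>x. T x - \<mu> *\<^sub>C x" D UNIV x]
  unfolding resolvent_set_def resolvent_def by simp

lemma bounded_linear_resolvent:
  "\<mu> \<in> resolvent_set D T \<Longrightarrow> bounded_linear (resolvent D T \<mu>)"
  by (simp add: resolvent_set_def)

text \<open>\<open>bounded_linear\<close> only provides real homogeneity; the complex one is
  inherited from \<open>T\<close> on \<open>D\<close>.\<close>

lemma resolvent_scaleC:
  assumes T: "closed_operator D T" and \<mu>: "\<mu> \<in> resolvent_set D T"
  shows "resolvent D T \<mu> (a *\<^sub>C x) = a *\<^sub>C resolvent D T \<mu> x"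
proof -
  define u where "u = resolvent D T \<mu> x"
  have u: "u \<in> D" "T u - \<mu> *\<^sub>C u = x"
    unfolding u_def using resolvent_in_domain[OF \<mu>] resolvent_right_inverse[OF \<mu>] by auto
  have "a *\<^sub>C u \<in> D" "T (a *\<^sub>C u) = a *\<^sub>C T u"
    using T u(1) unfolding closed_operator_def by (auto intro: complex_vector.subspace_scale)
  then have "resolvent D T \<mu> (a *\<^sub>C T u - \<mu> *\<^sub>C a *\<^sub>C u) = a *\<^sub>C u"
    using resolvent_left_inverse[OF \<mu>] by metis
  moreover have "a *\<^sub>C T u - \<mu> *\<^sub>C a *\<^sub>C u = a *\<^sub>C x"
    unfolding u(2) [symmetric]
    by (simp add: complex_vector.scale_right_diff_distrib mult.commute)
  ultimately show ?thesis by (simp add: u_def)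
qed

text \<open>With u the value of the resolvent at \<nu>, apply the resolvent at \<mu> to (T - \<mu>)
  u = x + (\<nu> - \<mu>) u.\<close>

lemma resolvent_identity:
  assumes T: "closed_operator D T"
    and \<mu>: "\<mu> \<in> resolvent_set D T" and \<nu>: "\<nu> \<in> resolvent_set D T"
  shows "resolvent D T \<nu> x =
    resolvent D T \<mu> x + (\<nu> - \<mu>) *\<^sub>C resolvent D T \<mu> (resolvent D T \<nu> x)"
proof -
  interpret R: bounded_linear "resolvent D T \<mu>"
    by (rule bounded_linear_resolvent[OF \<mu>])
  define u where "u = resolvent D T \<nu> x"
  have u: "u \<in> D" "T u - \<nu> *\<^sub>C u = x"
    unfolding u_def using resolvent_in_domain[OF \<nu>] resolvent_right_inverse[OF \<nu>] by auto
  have "T u - \<mu> *\<^sub>C u = x + (\<nu> - \<mu>) *\<^sub>C u"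
    unfolding u(2) [symmetric] by (simp add: complex_vector.scale_left_diff_distrib)
  then have "u = resolvent D T \<mu> (x + (\<nu> - \<mu>) *\<^sub>C u)"
    using resolvent_left_inverse[OF \<mu> u(1)] by simp
  then show ?thesis
    unfolding u_def by (simp add: R.add resolvent_scaleC[OF T \<mu>])
qed

lemma resolvent_funpow_scaleC:
  assumes "closed_operator D T" "\<mu> \<in> resolvent_set D T"
  shows "(resolvent D T \<mu> ^^ n) (a *\<^sub>C x) = a *\<^sub>C (resolvent D T \<mu> ^^ n) x"
  by (induction n) (simp_all add: resolvent_scaleC[OF assms])

text \<open>Iterating the resolvent identity gives a finite Neumann expansion with exact remainder,
  so no convergence of a series has to be discussed.\<close>

lemma resolvent_expansion:
  assumes T: "closed_operator D T"
    and \<mu>: "\<mu> \<in> resolvent_set D T" and \<nu>: "\<nu> \<in> resolvent_set D T"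
  shows "resolvent D T \<nu> x =
    (\<Sum>k<n. (\<nu> - \<mu>) ^ k *\<^sub>C (resolvent D T \<mu> ^^ Suc k) x)
      + (\<nu> - \<mu>) ^ n *\<^sub>C (resolvent D T \<mu> ^^ n) (resolvent D T \<nu> x)"
proof (induction n)
  case 0
  then show ?case by simp
next
  case (Suc n)
  let ?R = "resolvent D T \<mu>" and ?u = "resolvent D T \<nu> x"
  have add: "(?R ^^ n) (y + z) = (?R ^^ n) y + (?R ^^ n) z" for y z
    by (induction n)
      (simp_all add: linear_add[OF bounded_linear.linear[OF bounded_linear_resolvent[OF \<mu>]]])
  \<comment> \<open>One more use of the identity splits the remainder into the next term and a
    remainder of higher order.\<close>
  have "(?R ^^ n) ?u = (?R ^^ Suc n) x + (\<nu> - \<mu>) *\<^sub>C (?R ^^ Suc n) ?u"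
    by (subst resolvent_identity[OF T \<mu> \<nu>])
      (simp add: add resolvent_funpow_scaleC[OF T \<mu>] funpow_swap1)
  then have "(\<nu> - \<mu>) ^ n *\<^sub>C (?R ^^ n) ?u =
      (\<nu> - \<mu>) ^ n *\<^sub>C ((?R ^^ Suc n) x + (\<nu> - \<mu>) *\<^sub>C (?R ^^ Suc n) ?u)"
    by (rule arg_cong)
  also have "\<dots> = (\<nu> - \<mu>) ^ n *\<^sub>C (?R ^^ Suc n) x
      + (\<nu> - \<mu>) ^ Suc n *\<^sub>C (?R ^^ Suc n) ?u"
    by (simp add: complex_vector.scale_right_distrib mult.commute)
  finally show ?case
    by (intro trans[OF Suc.IH]) (simp only: sum.lessThan_Suc add.assoc)
qed

lemma norm_funpow_le:
  fixes f :: "'a::real_normed_vector \<Rightarrow> 'a"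
  assumes f: "bounded_linear f"
  shows "norm ((f ^^ n) x) \<le> onorm f ^ n * norm x"
proof (induction n)
  case 0
  then show ?case by simp
next
  case (Suc n)
  have "norm (f ((f ^^ n) x)) \<le> onorm f * norm ((f ^^ n) x)"
    by (rule onorm[OF f])
  also have "\<dots> \<le> onorm f * (onorm f ^ n * norm x)"
    by (intro mult_left_mono Suc.IH onorm_pos_le f)
  finally show ?case by (simp add: mult.assoc)
qed

section \<open>The perturbed norm bound\<close>

lemma norm_resolvent_add_le:
  fixes D :: "'a::complex_normed_vector set"
  assumes T: "closed_operator D T"
    and ball: "cball \<mu> r \<subseteq> resolvent_set D T"
    and M: "\<And>\<nu>. \<nu> \<in> cball \<mu> r \<Longrightarrow> onorm (resolvent D T \<nu>) \<le> M"
    and r: "0 \<le> r" "r * M < 1" and e: "norm e \<le> 1" and \<zeta>: "cmod \<zeta> \<le> 1"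
  shows "norm (resolvent D T \<mu> e
    + (\<zeta> * of_real r / 2) *\<^sub>C resolvent D T \<mu> (resolvent D T \<mu> e)) \<le> M"
proof -
  let ?R = "resolvent D T \<mu>"
  let ?x = "?R e + (\<zeta> * of_real r / 2) *\<^sub>C ?R (?R e)"
  have \<mu>: "\<mu> \<in> cball \<mu> r" "\<mu> \<in> resolvent_set D T" using r ball by auto
  have bl: "bounded_linear ?R" by (rule bounded_linear_resolvent[OF \<mu>(2)])
  have M0: "0 \<le> M" using onorm_pos_le[OF bl] M[OF \<mu>(1)] by simp
  have pow: "norm ((?R ^^ n) y) \<le> M ^ n * norm y" for n y
    using norm_funpow_le[OF bl, of n y]
      power_mono[OF M[OF \<mu>(1)] onorm_pos_le[OF bl], of n]
    by (meson mult_right_mono norm_ge_zero order_trans)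
  \<comment> \<open>The first error term comes from the Neumann remainder, the second from the
    aliased coefficient \<open>a (N - 1)\<close>.\<close>
  have est: "norm ?x \<le> M + (r * M) ^ N * M + (r * M) ^ (N - 1) * M" if N: "N \<ge> 3" for N
  proof -
    \<comment> \<open>Absorbing the radius into the coefficients leaves a polynomial in the
      unimodular direction \<open>w\<close>.\<close>
    define a where "a k = of_real r ^ k *\<^sub>C (?R ^^ Suc k) e" for k
    have "norm (a 0 + (\<zeta> / 2) *\<^sub>C a 1 + (cnj \<zeta> / 2) *\<^sub>C a (N - 1)) \<le> M + (r * M) ^ N * M"
    proof (rule norm_truncation_le[OF N \<zeta>])
      fix w :: complex
      assume w: "cmod w = 1"
      define \<nu> where "\<nu> = \<mu> + of_real r * w"
      have \<nu>: "\<nu> \<in> cball \<mu> r"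
        using r w by (simp add: \<nu>_def dist_norm norm_mult)
      then have \<nu>': "\<nu> \<in> resolvent_set D T" using ball by auto
      define v where "v = resolvent D T \<nu> e"
      have v: "norm v \<le> M"
      proof -
        have "norm v \<le> onorm (resolvent D T \<nu>) * norm e"
          unfolding v_def by (rule onorm[OF bounded_linear_resolvent[OF \<nu>']])
        also have "\<dots> \<le> M * 1"
          by (intro mult_mono M[OF \<nu>] e M0 norm_ge_zero)
        finally show ?thesis by simp
      qed
      have "(\<nu> - \<mu>) ^ k *\<^sub>C (?R ^^ Suc k) e = w ^ k *\<^sub>C a k" for k
        by (simp add: a_def \<nu>_def power_mult_distrib mult.commute)
      then have "v = (\<Sum>k<N. w ^ k *\<^sub>C a k) + (\<nu> - \<mu>) ^ N *\<^sub>C (?R ^^ N) v"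
        using resolvent_expansion[OF T \<mu>(2) \<nu>', of e N] unfolding v_def by simp
      then have "norm (\<Sum>k<N. w ^ k *\<^sub>C a k) = norm (v - (\<nu> - \<mu>) ^ N *\<^sub>C (?R ^^ N) v)"
        by (metis add_diff_cancel_right')
      also have "\<dots> \<le> norm v + norm ((\<nu> - \<mu>) ^ N *\<^sub>C (?R ^^ N) v)"
        by (rule norm_triangle_ineq4)
      also have "norm ((\<nu> - \<mu>) ^ N *\<^sub>C (?R ^^ N) v) = r ^ N * norm ((?R ^^ N) v)"
        using r w by (simp add: norm_scaleC \<nu>_def norm_power norm_mult)
      also have "r ^ N * norm ((?R ^^ N) v) \<le> r ^ N * (M ^ N * M)"
        using r M0 v by (intro mult_left_mono order_trans[OF pow]) auto
      finally show "norm (\<Sum>k<N. w ^ k *\<^sub>C a k) \<le> M + (r * M) ^ N * M"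
        using v by (simp add: power_mult_distrib mult.assoc)
    qed
    moreover have "norm ((cnj \<zeta> / 2) *\<^sub>C a (N - 1)) \<le> (r * M) ^ (N - 1) * M"
    proof -
      have "norm (a (N - 1)) \<le> r ^ (N - 1) * (M ^ Suc (N - 1) * norm e)"
        unfolding a_def using r pow[of "Suc (N - 1)" e]
        by (simp add: norm_scaleC norm_power mult_left_mono)
      also have "\<dots> \<le> r ^ (N - 1) * (M ^ Suc (N - 1) * 1)"
        using r M0 e by (intro mult_left_mono) auto
      finally have 1: "norm (a (N - 1)) \<le> (r * M) ^ (N - 1) * M"
        by (simp add: power_mult_distrib mult_ac)
      have "norm ((cnj \<zeta> / 2) *\<^sub>C a (N - 1)) \<le> 1 * norm (a (N - 1))"
        unfolding norm_scaleC using \<zeta> by (intro mult_right_mono) (auto simp: norm_divide)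
      with 1 show ?thesis by simp
    qed
    moreover have "?x = a 0 + (\<zeta> / 2) *\<^sub>C a 1"
      by (simp add: a_def)
    ultimately show ?thesis
      using norm_triangle_ineq4[of "a 0 + (\<zeta> / 2) *\<^sub>C a 1 + (cnj \<zeta> / 2) *\<^sub>C a (N - 1)"
          "(cnj \<zeta> / 2) *\<^sub>C a (N - 1)"] by simp
  qed
  have p: "(\<lambda>n. (r * M) ^ n) \<longlonglongrightarrow> 0"
    using r M0 by (intro LIMSEQ_realpow_zero) auto
  \<comment> \<open>Here \<open>N = Suc n\<close>, so \<open>n \<ge> 2\<close> ensures
    \<open>N \<ge> 3\<close>; both errors vanish because \<open>r * M < 1\<close>.\<close>
  have "(\<lambda>n. M + (r * M) ^ Suc n * M + (r * M) ^ n * M) \<longlonglongrightarrow> M + 0 * M + 0 * M"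
    by (intro tendsto_intros p LIMSEQ_Suc[OF p])
  then show ?thesis
    using est[of "Suc _"]
    by (intro tendsto_lowerbound[where F = sequentially and f = "\<lambda>n. M + (r * M) ^ Suc n * M + (r * M) ^ n * M"])
      (auto simp: eventually_sequentially intro!: exI[of _ 2])
qed

section \<open>Almost norming vectors and comparison of resolvents\<close>

theorem theorem3p2:
  fixes D :: "'a::complex_banach set" and T :: "'a \<Rightarrow> 'a"
    and U :: "complex set" and M :: real
  assumes "complex_uniformly_convex TYPE('a)"
    and "closed_operator D T"
    and "open U" and "U \<noteq> {}" and "U \<subseteq> resolvent_set D T"
    and "M > 0"
    and "\<forall>\<mu>\<in>U. onorm (resolvent D T \<mu>) = M"
  shows "\<forall>\<mu>\<in>resolvent_set D T. onorm (resolvent D T \<mu>) \<ge> M"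
proof
  fix \<mu>
  assume \<mu>: "\<mu> \<in> resolvent_set D T"
  note T = assms(2) and M = assms(6)
  obtain \<alpha> r0 where r0: "\<alpha> \<in> U" "r0 > 0" "cball \<alpha> r0 \<subseteq> U"
    using assms(3,4) by (meson ex_in_conv open_contains_cball)
  \<comment> \<open>The first bound keeps the disc inside \<open>U\<close>, the second gives
    \<open>r * M \<le> 1/2\<close>.\<close>
  define r where "r = min r0 (1 / (2 * M))"
  have r: "0 < r" "r * M < 1" "cball \<alpha> r \<subseteq> U"
  proof -
    show "0 < r" using r0(2) M by (simp add: r_def)
    have "r * M \<le> 1 / (2 * M) * M" using M by (intro mult_right_mono) (auto simp: r_def)
    then show "r * M < 1" using M by simp
    show "cball \<alpha> r \<subseteq> U" using r0(3) by (auto simp: r_def)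
  qed
  have \<alpha>: "\<alpha> \<in> resolvent_set D T" using r0(1) assms(5) by auto
  let ?R = "resolvent D T \<alpha>" and ?S = "resolvent D T \<mu>"
  have blR: "bounded_linear ?R" by (rule bounded_linear_resolvent[OF \<alpha>])
  have blS: "bounded_linear ?S" by (rule bounded_linear_resolvent[OF \<mu>])
  have almost: "\<exists>e. norm e = 1 \<and> M - \<eta> < norm (?R e) \<and> norm (?R (?R e)) \<le> \<eta>" if \<eta>: "\<eta> > 0" for \<eta>
  proof -
    \<comment> \<open>Chosen so that \<open>norm y \<le> \<epsilon>\<close>, for the
      \<open>y\<close> defined below, says exactly that
      \<open>norm (?R (?R e)) \<le> \<eta>\<close>.\<close>
    define \<epsilon> where "\<epsilon> = r / (2 * M) * \<eta>"
    have "\<epsilon> > 0" using \<eta> r M by (simp add: \<epsilon>_def)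
    then obtain \<delta> where \<delta>: "\<delta> > 0"
      and conv: "\<And>x y :: 'a. (\<forall>\<zeta>. cmod \<zeta> < 1 \<longrightarrow> norm (x + \<zeta> *\<^sub>C y) \<le> 1) \<and> norm y > \<epsilon>
          \<Longrightarrow> norm x < 1 - \<delta>"
      using assms(1) unfolding complex_uniformly_convex_def by meson
    \<comment> \<open>Zero serves the witness lemma, \<open>M - \<eta>\<close> makes
      \<open>e\<close> almost norming, and \<open>M * (1 - \<delta>)\<close> will contradict the
      conclusion of convexity. All three lie below \<open>M\<close>.\<close>
    define c where "c = max 0 (max (M - \<eta>) (M * (1 - \<delta>)))"
    have "0 \<le> c" "c < onorm ?R"
      using M \<eta> \<delta> assms(7) r0(1) by (auto simp: c_def algebra_simps)
    then obtain e where e: "norm e = 1" "c < norm (?R e)"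
      using onorm_less_witness[OF blR] by metis
    define x where "x = complex_of_real (1 / M) *\<^sub>C ?R e"
    define y where "y = complex_of_real (r / (2 * M)) *\<^sub>C ?R (?R e)"
    have "norm (x + \<zeta> *\<^sub>C y) \<le> 1" if "cmod \<zeta> < 1" for \<zeta>
    proof -
      have "x + \<zeta> *\<^sub>C y = complex_of_real (1 / M) *\<^sub>C (?R e + (\<zeta> * of_real r / 2) *\<^sub>C ?R (?R e))"
        by (simp add: x_def y_def complex_vector.scale_right_distrib mult_ac)
      moreover have "norm (?R e + (\<zeta> * of_real r / 2) *\<^sub>C ?R (?R e)) \<le> M"
        using r assms(5,7) e(1) that by (intro norm_resolvent_add_le[OF T]) auto
      ultimately show ?thesis
        using M by (simp only: norm_scaleC norm_of_real) (simp add: field_simps)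
    qed
    moreover have "\<not> norm x < 1 - \<delta>"
    proof -
      have "M * (1 - \<delta>) < norm (?R e)" using e(2) by (auto simp: c_def)
      then show ?thesis using M by (simp add: x_def norm_scaleC norm_divide field_simps)
    qed
    ultimately have "norm y \<le> \<epsilon>" using conv[of x y] by force
    moreover have "norm y = r / (2 * M) * norm (?R (?R e))"
      using r M by (simp add: y_def norm_scaleC norm_divide norm_mult)
    ultimately have "norm (?R (?R e)) \<le> \<eta>"
      unfolding \<epsilon>_def using r M by (simp add: field_simps)
    moreover have "M - \<eta> < norm (?R e)" using e(2) by (auto simp: c_def)
    ultimately show ?thesis using e(1) by blast
  qed
  let ?h = "\<mu> - \<alpha>" and ?K = "onorm ?S"
  \<comment> \<open>The identity with the roles of \<mu> and \<alpha> exchanged puts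
    \<open>?S\<close> outside; it is used at \<open>e\<close> and at \<open>?R e\<close>.\<close>
  have swap: "?S z = ?R z + ?h *\<^sub>C ?S (?R z)" for z
    using resolvent_identity[OF T \<mu> \<alpha>, of z]
    by (simp add: complex_vector.scale_left_diff_distrib algebra_simps)
  \<comment> \<open>Collects the losses per unit of \<eta>: one from \<open>e\<close> being only
    almost norming, the others from the two terms containing \<open>?R (?R e)\<close>.\<close>
  define C where "C = 1 + cmod ?h + cmod ?h * (cmod ?h * ?K)"
  have C: "C > 0"
    using onorm_pos_le[OF blS] by (simp add: C_def add_pos_nonneg)
  have bound: "M \<le> ?K + C * \<eta>" if \<eta>: "\<eta> > 0" for \<eta>
  proof -
    obtain e where e: "norm e = 1" "M - \<eta> < norm (?R e)" "norm (?R (?R e)) \<le> \<eta>"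
      using almost[OF \<eta>] by blast
    have "norm (?S (?R (?R e))) \<le> ?K * \<eta>"
      using onorm[OF blS, of "?R (?R e)"] mult_left_mono[OF e(3) onorm_pos_le[OF blS]] by linarith
    then have "norm (?h *\<^sub>C ?S (?R (?R e))) \<le> cmod ?h * (?K * \<eta>)"
      unfolding norm_scaleC by (intro mult_left_mono) auto
    then have "norm (?S (?R e)) \<le> \<eta> + cmod ?h * (?K * \<eta>)"
      using swap[of "?R e"] norm_triangle_ineq[of "?R (?R e)" "?h *\<^sub>C ?S (?R (?R e))"] e(3) by simp
    then have "norm (?h *\<^sub>C ?S (?R e)) \<le> cmod ?h * (\<eta> + cmod ?h * (?K * \<eta>))"
      unfolding norm_scaleC by (intro mult_left_mono) auto
    moreover have "norm (?R e) \<le> norm (?S e) + norm (?h *\<^sub>C ?S (?R e))"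
      using swap[of e] norm_triangle_ineq4[of "?S e" "?h *\<^sub>C ?S (?R e)"] by simp
    moreover have "norm (?S e) \<le> ?K"
      using onorm[OF blS, of e] e(1) by simp
    ultimately show ?thesis
      using e(2) by (simp add: C_def algebra_simps)
  qed
  show "M \<le> ?K"
  proof (rule field_le_epsilon)
    fix \<eta> :: real
    assume "\<eta> > 0"
    then show "M \<le> ?K + \<eta>" using bound[of "\<eta> / C"] C by simp
  qed
qed

end
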